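(* Let $R$ be a commutative ring with nonzero identity and $M$ a unitary $R$-module. Let $\mathcal{S}(M)$ be the set of all submodules of $M$, let $\phi:\mathcal{S}(M)\rightarrow \mathcal{S}(M)\cup\{\emptyset\}$ be a function, and let $P$ be a proper submodule of $M$, with $\phi(P)\subseteq P$. Then the following are equivalent: (i) $P$ is a $\phi$-prime submodule of $M$; (ii) for every $x\in M\setminus P$, $(P:_Rx)=(P:_RM)\cup(\phi(P):_Rx)$; (iii) for every $x\in M\setminus P$, $(P:_Rx)=(P:_RM)$ or $(P:_Rx)=(\phi(P):_Rx)$; (iv) for any ideal $I$ of $R$ and any submodule $L$ of $M$, if $IL\subseteq P$ and $IL\nsubseteq\phi(P)$, then $I\subseteq(P:_RM)$ or $L\subseteq P$.
   Context: For a submodule $N$ of $M$, $(N:_RM)=\{r\in R: rM\subseteq N\}$. For a subset $N\subseteq M$ (a submodule or $\emptyset$) and $x\in M$, $(N:_Rx)=\{r\in R: rx\in N\}$; in particular $(\emptyset:_Rx)=\emptyset$. A proper submodule $P$ of $M$ is $\phi$-prime if for all $r\in R$, $x\in M$, $rx\in P\setminus\phi(P)$ implies $r\in(P:_RM)$ or $x\in P$. *)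

theory Defs
  imports "HOL-Algebra.Ideal_Product" "HOL-Algebra.Module"
begin

definition submodules :: "('a, 'r) ring_scheme \<Rightarrow> ('a, 'b, 'm) module_scheme \<Rightarrow> 'b set set"
  where "submodules R M = {N. submodule N R M}"

definition colon_module ::
    "('a, 'r) ring_scheme \<Rightarrow> ('a, 'b, 'm) module_scheme \<Rightarrow> 'b set \<Rightarrow> 'a set"
  where "colon_module R M N = {r \<in> carrier R. \<forall>x \<in> carrier M. r \<odot>\<^bsub>M\<^esub> x \<in> N}"

definition colon_elem ::
    "('a, 'r) ring_scheme \<Rightarrow> ('a, 'b, 'm) module_scheme \<Rightarrow> 'b set \<Rightarrow> 'b \<Rightarrow> 'a set"
  where "colon_elem R M N x = {r \<in> carrier R. r \<odot>\<^bsub>M\<^esub> x \<in> N}"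

definition phi_prime_submodule ::
    "('a, 'r) ring_scheme \<Rightarrow> ('a, 'b, 'm) module_scheme \<Rightarrow> ('b set \<Rightarrow> 'b set) \<Rightarrow> 'b set \<Rightarrow> bool"
  where "phi_prime_submodule R M \<phi> P \<longleftrightarrow>
    submodule P R M \<and> P \<noteq> carrier M \<and>
    (\<forall>r \<in> carrier R. \<forall>x \<in> carrier M.
       r \<odot>\<^bsub>M\<^esub> x \<in> P - \<phi> P \<longrightarrow> r \<in> colon_module R M P \<or> x \<in> P)"

text \<open>The product \<open>I L\<close> of an ideal and a submodule consists of the finite sums of elements
  \<open>i x\<close> with \<open>i \<in> I\<close> and \<open>x \<in> L\<close>, defined in the same style as \<^const>\<open>ideal_prod\<close>. Zero and
  negatives are covered because \<open>I\<close> and \<open>L\<close> contain zero and are closed under negation.\<close>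

inductive_set ideal_smult :: "('a, 'b, 'm) module_scheme \<Rightarrow> 'a set \<Rightarrow> 'b set \<Rightarrow> 'b set"
  for M and I and L where
    smult: "\<lbrakk>i \<in> I; x \<in> L\<rbrakk> \<Longrightarrow> i \<odot>\<^bsub>M\<^esub> x \<in> ideal_smult M I L"
  | sum: "\<lbrakk>y \<in> ideal_smult M I L; z \<in> ideal_smult M I L\<rbrakk> \<Longrightarrow> y \<oplus>\<^bsub>M\<^esub> z \<in> ideal_smult M I L"

end

theory Submission
  imports Defs
begin

text \<open>For \<open>x \<notin> P\<close>, primeness says exactly that \<open>(P : x)\<close> is the union of \<open>(P : M)\<close> and
  \<open>(\<phi>(P) : x)\<close>, and an additive group that is the union of two subgroups equals one of them.
  Conversely, if \<open>I L \<subseteq> P\<close> while \<open>I \<nsubseteq> (P : M)\<close> and some \<open>y \<in> L\<close> lies outside \<open>P\<close>, then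
  \<open>I x \<subseteq> \<phi>(P)\<close> for each \<open>x \<in> L - P\<close>; an element \<open>x \<in> L \<inter> P\<close> is the difference of \<open>x + y\<close> and
  \<open>y\<close>, both in \<open>L - P\<close>, so \<open>I L \<subseteq> \<phi>(P)\<close>. Principal ideals and cyclic submodules
  recover primeness from the ideal form.\<close>

text \<open>Subtracting \<open>y\<close> recovers \<open>x\<close>. Read contrapositively, adding an
  element of \<open>N\<close> to an element of \<open>M\<close> outside \<open>N\<close> gives an
  element outside \<open>N\<close>, the form in which it is used below.\<close>

lemma (in module) submodule_add_cancel:
  assumes N: "submodule N R M" and x: "x \<in> carrier M" and y: "y \<in> N"
    and xy: "x \<oplus>\<^bsub>M\<^esub> y \<in> N"
  shows "x \<in> N"
proof -
  have yM: "y \<in> carrier M" using submoduleE(1)[OF N] y by blast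
  have "(x \<oplus>\<^bsub>M\<^esub> y) \<oplus>\<^bsub>M\<^esub> \<ominus>\<^bsub>M\<^esub> y \<in> N"
    using submoduleE(3,5)[OF N] y xy by blast
  also have "(x \<oplus>\<^bsub>M\<^esub> y) \<oplus>\<^bsub>M\<^esub> \<ominus>\<^bsub>M\<^esub> y = x"
    using x yM by (simp add: M.a_assoc M.r_neg)
  finally show ?thesis .
qed

lemma (in module) cyclic_submodule:
  assumes x: "x \<in> carrier M"
  shows "submodule ((\<lambda>r. r \<odot>\<^bsub>M\<^esub> x) ` carrier R) R M"
proof (rule submoduleI)
  show "(\<lambda>r. r \<odot>\<^bsub>M\<^esub> x) ` carrier R \<subseteq> carrier M" using x by auto
  show "\<zero>\<^bsub>M\<^esub> \<in> (\<lambda>r. r \<odot>\<^bsub>M\<^esub> x) ` carrier R"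
    using x by (intro image_eqI[of _ _ "\<zero>"]) auto
next
  fix a assume "a \<in> (\<lambda>r. r \<odot>\<^bsub>M\<^esub> x) ` carrier R"
  then obtain r where "r \<in> carrier R" "a = r \<odot>\<^bsub>M\<^esub> x" by blast
  then show "\<ominus>\<^bsub>M\<^esub> a \<in> (\<lambda>r. r \<odot>\<^bsub>M\<^esub> x) ` carrier R"
    using x by (intro image_eqI[of _ _ "\<ominus> r"]) (auto simp: smult_l_minus)
next
  fix a b assume "a \<in> (\<lambda>r. r \<odot>\<^bsub>M\<^esub> x) ` carrier R" "b \<in> (\<lambda>r. r \<odot>\<^bsub>M\<^esub> x) ` carrier R"
  then obtain r s where "r \<in> carrier R" "a = r \<odot>\<^bsub>M\<^esub> x" "s \<in> carrier R" "b = s \<odot>\<^bsub>M\<^esub> x"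
    by blast
  then show "a \<oplus>\<^bsub>M\<^esub> b \<in> (\<lambda>r. r \<odot>\<^bsub>M\<^esub> x) ` carrier R"
    using x by (intro image_eqI[of _ _ "r \<oplus> s"]) (auto simp: smult_l_distr)
next
  fix a b assume a: "a \<in> carrier R" and "b \<in> (\<lambda>r. r \<odot>\<^bsub>M\<^esub> x) ` carrier R"
  then obtain r where "r \<in> carrier R" "b = r \<odot>\<^bsub>M\<^esub> x" by blast
  then show "a \<odot>\<^bsub>M\<^esub> b \<in> (\<lambda>r. r \<odot>\<^bsub>M\<^esub> x) ` carrier R"
    using x a by (intro image_eqI[of _ _ "a \<otimes> r"]) (auto simp: smult_assoc1)
qed

text \<open>Induction over finite sums of products. \<open>N\<close> is any set closed under
  addition, so it may also be an empty value of \<phi>.\<close>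

lemma ideal_smult_subsetI:
  assumes "\<And>i x. \<lbrakk>i \<in> I; x \<in> L\<rbrakk> \<Longrightarrow> i \<odot>\<^bsub>M\<^esub> x \<in> N"
    and "\<And>y z. \<lbrakk>y \<in> N; z \<in> N\<rbrakk> \<Longrightarrow> y \<oplus>\<^bsub>M\<^esub> z \<in> N"
  shows "ideal_smult M I L \<subseteq> N"
proof
  fix y assume "y \<in> ideal_smult M I L"
  then show "y \<in> N" by induction (auto intro: assms)
qed

lemma (in module) colon_elem_add_cancel:
  assumes N: "submodule N R M" and x: "x \<in> carrier M" and a: "a \<in> carrier R"
    and b: "b \<in> colon_elem R M N x" and ab: "a \<oplus> b \<in> colon_elem R M N x"
  shows "a \<in> colon_elem R M N x"
  using submodule_add_cancel[OF N, of "a \<odot>\<^bsub>M\<^esub> x" "b \<odot>\<^bsub>M\<^esub> x"] x a b ab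
  by (auto simp: colon_elem_def smult_l_distr)

text \<open>As an intersection of sets (N : x), the set (N : M) inherits cancellation from them
  pointwise.\<close>

lemma colon_module_eq_INT:
  "colon_module R M N = {r \<in> carrier R. \<forall>x \<in> carrier M. r \<in> colon_elem R M N x}"
  by (auto simp: colon_module_def colon_elem_def)

lemma (in module) colon_module_add_cancel:
  assumes N: "submodule N R M" and a: "a \<in> carrier R"
    and b: "b \<in> colon_module R M N" and ab: "a \<oplus> b \<in> colon_module R M N"
  shows "a \<in> colon_module R M N"
  using colon_elem_add_cancel[OF N _ a] a b ab by (auto simp: colon_module_eq_INT)

lemma colon_elem_mono: "N \<subseteq> P \<Longrightarrow> colon_elem R M N x \<subseteq> colon_elem R M P x"
  by (auto simp: colon_elem_def)

lemma colon_module_subset_colon_elem: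
  "x \<in> carrier M \<Longrightarrow> colon_module R M P \<subseteq> colon_elem R M P x"
  by (auto simp: colon_module_def colon_elem_def)

lemma (in module) colon_elem_union_cases:
  assumes P: "submodule P R M" and N: "submodule N R M \<or> N = {}" and x: "x \<in> carrier M"
    and eq: "colon_elem R M P x = colon_module R M P \<union> colon_elem R M N x"
  shows "colon_elem R M P x = colon_module R M P \<or> colon_elem R M P x = colon_elem R M N x"
proof (rule ccontr)
  assume "\<not> ?thesis"
  then obtain b c where b: "b \<in> colon_module R M P" "b \<notin> colon_elem R M N x"
    and c: "c \<in> colon_elem R M N x" "c \<notin> colon_module R M P"
    using eq by blast
  have R: "b \<in> carrier R" "c \<in> carrier R"
    using b c by (auto simp: colon_module_def colon_elem_def)
  \<comment> \<open>The element \<open>c\<close> sends \<open>x\<close> into \<open>N\<close>, which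
    rules out the empty case.\<close>
  have N': "submodule N R M" using N c by (auto simp: colon_elem_def)
  have "b \<in> colon_elem R M P x" "c \<in> colon_elem R M P x" using b c eq by auto
  then have "b \<oplus> c \<in> colon_elem R M P x"
    using x submoduleE(5)[OF P] by (auto simp: colon_elem_def smult_l_distr)
  \<comment> \<open>Neither part can contain the sum: in (P : M) cancelling \<open>b\<close> would
    leave \<open>c\<close> there, and in (N : x) cancelling \<open>c\<close> would leave
    \<open>b\<close> there. The order of the summands is chosen to fit each cancellation.\<close>
  then consider "c \<oplus> b \<in> colon_module R M P" | "b \<oplus> c \<in> colon_elem R M N x"
    using eq R by (auto simp: R.a_comm)
  then show False
    using colon_module_add_cancel[OF P R(2) b(1)] colon_elem_add_cancel[OF N' x R(1) c(1)] b c
    by cases auto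
qed

text \<open>Since \<phi>(P) lies in \<open>P\<close>, the union is always contained in (P : x). The
  content of the equation is the other inclusion, which is the primeness condition for this fixed
  \<open>x\<close>.\<close>

lemma phi_prime_submodule_iff_colon_union:
  assumes "submodule P R M" "P \<noteq> carrier M" "\<phi> P \<subseteq> P"
  shows "phi_prime_submodule R M \<phi> P \<longleftrightarrow>
    (\<forall>x \<in> carrier M - P.
      colon_elem R M P x = colon_module R M P \<union> colon_elem R M (\<phi> P) x)"
proof -
  have "colon_elem R M P x = colon_module R M P \<union> colon_elem R M (\<phi> P) x \<longleftrightarrow>
      (\<forall>r \<in> carrier R. r \<odot>\<^bsub>M\<^esub> x \<in> P - \<phi> P \<longrightarrow> r \<in> colon_module R M P)"
    if "x \<in> carrier M" for x
    using that assms(3) by (auto simp: colon_elem_def colon_module_def)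
  then show ?thesis
    using assms(1,2) unfolding phi_prime_submodule_def by blast
qed

lemma (in module) ideal_smult_subset_phi:
  assumes P: "submodule P R M" and N: "submodule N R M \<or> N = {}"
    and colon: "\<And>x. x \<in> carrier M - P \<Longrightarrow>
      colon_elem R M P x = colon_module R M P \<or> colon_elem R M P x = colon_elem R M N x"
    and I: "ideal I R" "\<not> I \<subseteq> colon_module R M P"
    and L: "submodule L R M" "\<not> L \<subseteq> P"
    and IL: "ideal_smult M I L \<subseteq> P"
  shows "ideal_smult M I L \<subseteq> N"
proof (rule ideal_smult_subsetI)
  have outside: "i \<odot>\<^bsub>M\<^esub> x \<in> N" if i: "i \<in> I" and x: "x \<in> L" "x \<notin> P" for i x
  proof -
    have sub: "I \<subseteq> colon_elem R M P x"
      using IL x ideal_smult.smult[of _ I x L M] ideal.Icarr[OF I(1)]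
      by (auto simp: colon_elem_def)
    \<comment> \<open>If (P : x) were (P : M), then \<open>I\<close> would lie in (P : M), against
      the choice of \<open>I\<close>; so the other alternative holds.\<close>
    with colon[of x] I(2) x submoduleE(1)[OF L(1)]
    have "colon_elem R M P x = colon_elem R M N x" by blast
    with sub i show ?thesis by (auto simp: colon_elem_def)
  qed
  fix i x assume i: "i \<in> I" and x: "x \<in> L"
  show "i \<odot>\<^bsub>M\<^esub> x \<in> N"
  proof (cases "x \<in> P")
    case True
    obtain y where y: "y \<in> L" "y \<notin> P" using L(2) by blast
    have carr: "i \<in> carrier R" "x \<in> carrier M" "y \<in> carrier M"
      using ideal.Icarr[OF I(1) i] x y submoduleE(1)[OF L(1)] by auto
    have "x \<oplus>\<^bsub>M\<^esub> y \<in> L" using submoduleE(5)[OF L(1)] x y by blast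
    \<comment> \<open>Otherwise cancelling \<open>x\<close>, which lies in \<open>P\<close>, would
      put \<open>y\<close> in \<open>P\<close>.\<close>
    moreover have "x \<oplus>\<^bsub>M\<^esub> y \<notin> P"
      using submodule_add_cancel[OF P carr(3) True] y carr by (auto simp: M.a_comm)
    ultimately have xy: "i \<odot>\<^bsub>M\<^esub> x \<oplus>\<^bsub>M\<^esub> i \<odot>\<^bsub>M\<^esub> y \<in> N"
      using outside[OF i] carr by (metis smult_r_distr)
    have "i \<odot>\<^bsub>M\<^esub> y \<in> N" using outside[OF i y] .
    \<comment> \<open>\<open>N\<close> contains the multiple of \<open>y\<close>, so it is nonempty
      and hence a submodule, and cancellation applies.\<close>
    with N xy carr show ?thesis
      by (auto intro: submodule_add_cancel)
  qed (use outside i x in blast)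
next
  show "\<And>y z. \<lbrakk>y \<in> N; z \<in> N\<rbrakk> \<Longrightarrow> y \<oplus>\<^bsub>M\<^esub> z \<in> N"
    using N submoduleE(5) by blast
qed

text \<open>By commutativity (a r)(s x) = (a s)(r x), so every generator of the product is a
  multiple of \<open>r x\<close>.\<close>

lemma (in module) ideal_smult_cgenideal_cyclic_subset:
  assumes P: "submodule P R M" and r: "r \<in> carrier R" and x: "x \<in> carrier M"
    and rx: "r \<odot>\<^bsub>M\<^esub> x \<in> P"
  shows "ideal_smult M (PIdl r) ((\<lambda>s. s \<odot>\<^bsub>M\<^esub> x) ` carrier R) \<subseteq> P"
proof (rule ideal_smult_subsetI)
  fix i y assume "i \<in> PIdl r" "y \<in> (\<lambda>s. s \<odot>\<^bsub>M\<^esub> x) ` carrier R"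
  then obtain a s where as: "a \<in> carrier R" "i = a \<otimes> r" "s \<in> carrier R" "y = s \<odot>\<^bsub>M\<^esub> x"
    by (auto simp: cgenideal_def)
  have "i \<odot>\<^bsub>M\<^esub> y = ((a \<otimes> r) \<otimes> s) \<odot>\<^bsub>M\<^esub> x"
    using as r x by (simp add: smult_assoc1)
  also have "(a \<otimes> r) \<otimes> s = (a \<otimes> s) \<otimes> r" using as r by (simp add: R.m_ac)
  also have "\<dots> \<odot>\<^bsub>M\<^esub> x = (a \<otimes> s) \<odot>\<^bsub>M\<^esub> (r \<odot>\<^bsub>M\<^esub> x)" using as r x by (simp add: smult_assoc1)
  also have "\<dots> \<in> P" using submoduleE(4)[OF P _ rx] as by simp
  finally show "i \<odot>\<^bsub>M\<^esub> y \<in> P" .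
qed (use submoduleE(5)[OF P] in blast)

theorem theorem2p11:
  fixes R :: "('a, 'r) ring_scheme"
    and M :: "('a, 'b, 'm) module_scheme"
    and \<phi> :: "'b set \<Rightarrow> 'b set"
    and P :: "'b set"
  assumes "module R M"
    and "\<one>\<^bsub>R\<^esub> \<noteq> \<zero>\<^bsub>R\<^esub>"
    and "\<phi> \<in> submodules R M \<rightarrow> submodules R M \<union> {{}}"
    and "submodule P R M"
    and "P \<noteq> carrier M"
    and "\<phi> P \<subseteq> P"
  shows "(phi_prime_submodule R M \<phi> P \<longleftrightarrow>
           (\<forall>x \<in> carrier M - P.
              colon_elem R M P x = colon_module R M P \<union> colon_elem R M (\<phi> P) x)) \<and>
         (phi_prime_submodule R M \<phi> P \<longleftrightarrow>
           (\<forall>x \<in> carrier M - P.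
              colon_elem R M P x = colon_module R M P \<or>
              colon_elem R M P x = colon_elem R M (\<phi> P) x)) \<and>
         (phi_prime_submodule R M \<phi> P \<longleftrightarrow>
           (\<forall>I L. ideal I R \<and> submodule L R M \<and>
              ideal_smult M I L \<subseteq> P \<and> \<not> ideal_smult M I L \<subseteq> \<phi> P \<longrightarrow>
              I \<subseteq> colon_module R M P \<or> L \<subseteq> P))"
proof -
  interpret module R M by fact
  note P = \<open>submodule P R M\<close>
  let ?prime = "phi_prime_submodule R M \<phi> P"
  let ?union = "\<forall>x \<in> carrier M - P.
    colon_elem R M P x = colon_module R M P \<union> colon_elem R M (\<phi> P) x"
  let ?cases = "\<forall>x \<in> carrier M - P.
    colon_elem R M P x = colon_module R M P \<or> colon_elem R M P x = colon_elem R M (\<phi> P) x"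
  let ?ideals = "\<forall>I L. ideal I R \<and> submodule L R M \<and>
    ideal_smult M I L \<subseteq> P \<and> \<not> ideal_smult M I L \<subseteq> \<phi> P \<longrightarrow> I \<subseteq> colon_module R M P \<or> L \<subseteq> P"
  have phi: "submodule (\<phi> P) R M \<or> \<phi> P = {}"
    using assms(3) P by (auto simp: submodules_def Pi_iff)
  have prime_union: "?prime \<longleftrightarrow> ?union"
    using phi_prime_submodule_iff_colon_union assms(4-6) .
  have union_cases: "?union \<longleftrightarrow> ?cases"
  proof
    assume ?union
    then show ?cases using colon_elem_union_cases[OF P phi] by blast
  next
    assume ?cases
    \<comment> \<open>Both parts of the union lie in (P : x), so once one of them equals (P : x), so
      does the union.\<close>
    then show ?union
      using colon_module_subset_colon_elem[of _ M R P] colon_elem_mono[OF assms(6), of R M]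
      by blast
  qed
  have cases_ideals: "?cases \<Longrightarrow> ?ideals"
    using ideal_smult_subset_phi[OF P phi] by blast
  have ideals_prime: ?prime if ideals: ?ideals
    unfolding phi_prime_submodule_def
  proof (intro conjI ballI impI P \<open>P \<noteq> carrier M\<close>)
    fix r x assume r: "r \<in> carrier R" and x: "x \<in> carrier M" and rx: "r \<odot>\<^bsub>M\<^esub> x \<in> P - \<phi> P"
    let ?L = "(\<lambda>s. s \<odot>\<^bsub>M\<^esub> x) ` carrier R"
    have mem: "r \<in> PIdl\<^bsub>R\<^esub> r" "x \<in> ?L"
      using r x by (auto simp: R.cgenideal_self intro: image_eqI[of _ _ "\<one>\<^bsub>R\<^esub>"])
    \<comment> \<open>The product \<open>r x\<close> is itself a generator and lies outside
      \<phi>(P).\<close>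
    have "\<not> ideal_smult M (PIdl\<^bsub>R\<^esub> r) ?L \<subseteq> \<phi> P"
      using ideal_smult.smult[OF mem] rx by blast
    moreover have "ideal_smult M (PIdl\<^bsub>R\<^esub> r) ?L \<subseteq> P"
      using ideal_smult_cgenideal_cyclic_subset[OF P r x] rx by blast
    ultimately have "PIdl\<^bsub>R\<^esub> r \<subseteq> colon_module R M P \<or> ?L \<subseteq> P"
      using ideals R.cgenideal_ideal[OF r] cyclic_submodule[OF x] by blast
    then show "r \<in> colon_module R M P \<or> x \<in> P" using mem by blast
  qed
  show ?thesis
    using prime_union union_cases cases_ideals ideals_prime by argo
qed

end
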